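(* Consider the seven semantics Cog (cogent), CyCog (cyclically cogent), WAd (weakly admissible), WC (weakly complete), StrTen (strongly tenable), Ten (tenable), StaTen (statically tenable), and the directed graph on them with "solid" edges Cog$\to$CyCog, Cog$\to$WAd, Cog$\to$StrTen, StrTen$\to$Ten, Ten$\to$StaTen, and "dashed" edges StaTen$\to$WC, WAd$\to$WC. Then, restricted to finite argumentation frameworks: (i) For each solid edge $\sigma\to\tau$, every $\sigma$-extension of every finite AF is a $\tau$-extension; for each dashed edge $\sigma\to\tau$, every $\sigma$-extension of every finite AF is a subset of some $\tau$-extension. (Consequently these relations hold along directed paths, composing to inclusion-based refinement whenever a dashed edge is used.) (ii) For any ordered pair $(\sigma,\tau)$ of distinct semantics such that there is no directed path (using solid and dashed edges) from $\sigma$ to $\tau$, there exist a finite AF $\mathcal F$ and a set $A\in\sigma(\mathcal F)$ such that $A$ is not contained in any $\tau$-extension of $\mathcal F$. (iii) For any ordered pair $(\sigma,\tau)$ of distinct semantics such that there is no directed path from $\sigma$ to $\tau$ using only solid edges, there exist a finite AF $\mathcal F$ and a set $A\subseteq F$ with $A\in\sigma(\mathcal F)$ and $A\notin\tau(\mathcal F)$.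
   Context: An argumentation framework (AF) $\mathcal F=(F,\rightarrowtail)$ consists of a set $F$ of arguments and a binary attack relation $\rightarrowtail\subseteq F\times F$. An argument $a$ attacks a set $B$ if $a\rightarrowtail b$ for some $b\in B$. $A^+=\{x\in F:\exists a\in A,\ a\rightarrowtail x\}$. A set is conflict-free if none of its elements attacks one of its elements. For $A,B\subseteq F$, $A$ is as cogent as $B$, written $A\succeq B$, if $A$ is conflict-free and every $b\in B$ that attacks $A$ belongs to $A^+$. We write $B\succ A$ (and $A\prec B$) if $B\succeq A$ and not $A\succeq B$. A semantics $\sigma$ assigns to each AF a set $\sigma(\mathcal F)$ of subsets of $F$ (its $\sigma$-extensions). Cogent: $E$ is cogent if for every $D\subseteq F$, $D\succeq E$ implies $E\succeq D$. Cyclically cogent: $E$ is cyclically cogent if for every $D\subseteq F$ at least one holds: (1) $D\not\succeq E$; (2) $E\succeq D$; (3) there is a chain $D=D_1\prec D_2\prec\dots\prec D_n=E$. Weakly admissible (finite $F$): the $A$-reduct $\mathcal F^A$ is the restriction of $\mathcal F$ to $F\setminus(A\cup A^+)$; $A$ is weakly admissible if it is conflict-free and every $y\in F$ attacking $A$ belongs to no weakly admissible set of $\mathcal F^A$ (recursive definition). Weakly complete: a weakly complete labeling is a map $L:F\to\{\mathtt{in},\mathtt{out},\mathtt{undec}\}$ such that for every $a$: if $L(a)=\mathtt{in}$ then no attacker of $a$ is $\mathtt{in}$; if $L(a)=\mathtt{out}$ then some attacker of $a$ is $\mathtt{in}$; if $L(a)=\mathtt{undec}$ then some attacker of $a$ is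 $\mathtt{undec}$ and none is $\mathtt{in}$. A weakly complete extension is the set of $\mathtt{in}$-labeled arguments of such a labeling. Statically tenable: $A$ is statically tenable if for every finite conflict-free $B\subseteq F$ there is a conflict-free $C\supseteq A$ with $C\succeq B$. Strong tenability game: a strong tenability dispute is a finite sequence $(X_0,\dots,X_n)$ of subsets of $F$, even-indexed sets being moves of Pro and odd-indexed ones moves of Opp, such that (1) each $X_i$ is conflict-free; (2) $X_i\subseteq X_{i+2}$; (3) $X_1$ and each $X_{i+2}\setminus X_i$ are finite; (4) every Pro move $X_{2k}$ ($k\ge1$) satisfies $X_{2k}\succeq X_{2k-1}$; (5) every Opp move satisfies $X_{2k}\not\succeq X_{2k+1}$. Tenability game: same but with (4') $X_{i+1}\succeq X_i$ for all $i$ and (5') every Opp move satisfies $X_{2k+1}\succ X_{2k}$. Play starts with $X_0=A$; players alternately extend the dispute legally; a dispute with no legal extension is concluded and is won by the player who made the last move. A Pro strategy is winning if every concluded dispute from $X_0=A$ in which Pro follows it is won by Pro (infinite plays are Pro wins). $A$ is strongly tenable (resp. tenable) if Pro has a winning strategy in the strong tenability (resp. tenability) game from $X_0=A$. *)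

theory Defs
  imports Main
begin

definition AF :: "'a set \<Rightarrow> ('a \<times> 'a) set \<Rightarrow> bool" where
  "AF F R \<longleftrightarrow> R \<subseteq> F \<times> F"

definition attacks :: "('a \<times> 'a) set \<Rightarrow> 'a \<Rightarrow> 'a set \<Rightarrow> bool" where
  "attacks R a B \<longleftrightarrow> (\<exists>b\<in>B. (a, b) \<in> R)"

definition plus :: "('a \<times> 'a) set \<Rightarrow> 'a set \<Rightarrow> 'a set" where
  "plus R A = {x. \<exists>a\<in>A. (a, x) \<in> R}"

definition cf :: "('a \<times> 'a) set \<Rightarrow> 'a set \<Rightarrow> bool" where
  "cf R A \<longleftrightarrow> (\<forall>a\<in>A. \<forall>b\<in>A. (a, b) \<notin> R)"

definition cogent_as :: "('a \<times> 'a) set \<Rightarrow> 'a set \<Rightarrow> 'a set \<Rightarrow> bool" where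
  "cogent_as R A B \<longleftrightarrow> cf R A \<and> (\<forall>b\<in>B. attacks R b A \<longrightarrow> b \<in> plus R A)"

definition strictly_cogent :: "('a \<times> 'a) set \<Rightarrow> 'a set \<Rightarrow> 'a set \<Rightarrow> bool" where
  "strictly_cogent R B A \<longleftrightarrow> cogent_as R B A \<and> \<not> cogent_as R A B"

definition cogent :: "'a set \<Rightarrow> ('a \<times> 'a) set \<Rightarrow> 'a set \<Rightarrow> bool" where
  "cogent F R E \<longleftrightarrow> E \<subseteq> F \<and> (\<forall>D. D \<subseteq> F \<longrightarrow> cogent_as R D E \<longrightarrow> cogent_as R E D)"

text \<open>Chain D = D_1 \<prec> D_2 \<prec> ... \<prec> D_n = E of subsets of F: the transitive
  closure of the relation X \<prec> Y (i.e. Y \<succ> X) on subsets of F.\<close>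
definition prec_rel :: "'a set \<Rightarrow> ('a \<times> 'a) set \<Rightarrow> ('a set \<times> 'a set) set" where
  "prec_rel F R = {(X, Y). X \<subseteq> F \<and> Y \<subseteq> F \<and> strictly_cogent R Y X}"

definition cyc_cogent :: "'a set \<Rightarrow> ('a \<times> 'a) set \<Rightarrow> 'a set \<Rightarrow> bool" where
  "cyc_cogent F R E \<longleftrightarrow> E \<subseteq> F \<and>
     (\<forall>D. D \<subseteq> F \<longrightarrow> \<not> cogent_as R D E \<or> cogent_as R E D \<or> (D, E) \<in> (prec_rel F R)\<^sup>+)"

text \<open>Weak admissibility (finite AFs), by recursion on the size of F.
  The reduct by A is F - (A \<union> A+) with the restricted attack relation.
  For infinite F the predicate is (by convention) false; only finite AFs matter.\<close>

definition reduct_args :: "'a set \<Rightarrow> ('a \<times> 'a) set \<Rightarrow> 'a set \<Rightarrow> 'a set" where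
  "reduct_args F R A = F - (A \<union> plus R A)"

function wadm :: "'a set \<Rightarrow> ('a \<times> 'a) set \<Rightarrow> 'a set \<Rightarrow> bool" where
  "wadm F R A =
     (if \<not> (finite F \<and> A \<subseteq> F) then False
      else if A = {} then True
      else cf R A \<and>
        (\<forall>y\<in>F. attacks R y A \<longrightarrow>
           \<not> (\<exists>B. wadm (reduct_args F R A) (R \<inter> (reduct_args F R A \<times> reduct_args F R A)) B
                  \<and> y \<in> B)))"
  by auto
termination
proof (relation "measure (\<lambda>(F, R, A). card F)", goal_cases)
  case 1 show ?case by simp
next
  case (2 F R A y B)
  then have "reduct_args F R A \<subset> F" by (auto simp: reduct_args_def)
  with 2 show ?case by (simp add: psubset_card_mono)
qed

datatype lab = In | Out | Undec

definition wc_labeling :: "'a set \<Rightarrow> ('a \<times> 'a) set \<Rightarrow> ('a \<Rightarrow> lab) \<Rightarrow> bool" where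
  "wc_labeling F R L \<longleftrightarrow> (\<forall>a\<in>F.
     (L a = In \<longrightarrow> \<not> (\<exists>b\<in>F. (b, a) \<in> R \<and> L b = In)) \<and>
     (L a = Out \<longrightarrow> (\<exists>b\<in>F. (b, a) \<in> R \<and> L b = In)) \<and>
     (L a = Undec \<longrightarrow> (\<exists>b\<in>F. (b, a) \<in> R \<and> L b = Undec) \<and> \<not> (\<exists>b\<in>F. (b, a) \<in> R \<and> L b = In)))"

definition weakly_complete :: "'a set \<Rightarrow> ('a \<times> 'a) set \<Rightarrow> 'a set \<Rightarrow> bool" where
  "weakly_complete F R E \<longleftrightarrow> (\<exists>L. wc_labeling F R L \<and> E = {a\<in>F. L a = In})"

definition stat_tenable :: "'a set \<Rightarrow> ('a \<times> 'a) set \<Rightarrow> 'a set \<Rightarrow> bool" where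
  "stat_tenable F R A \<longleftrightarrow> A \<subseteq> F \<and>
     (\<forall>B. B \<subseteq> F \<and> finite B \<and> cf R B \<longrightarrow>
        (\<exists>C. C \<subseteq> F \<and> cf R C \<and> A \<subseteq> C \<and> cogent_as R C B))"

text \<open>A dispute (X_0, ..., X_n) is a nonempty list d with d!i = X_i.
  Even indices are Pro moves, odd indices Opp moves.\<close>

definition strong_dispute :: "'a set \<Rightarrow> ('a \<times> 'a) set \<Rightarrow> 'a set list \<Rightarrow> bool" where
  "strong_dispute F R d \<longleftrightarrow> d \<noteq> [] \<and>
     (\<forall>i<length d. d!i \<subseteq> F \<and> cf R (d!i)) \<and>
     (\<forall>i. i + 2 < length d \<longrightarrow> d!i \<subseteq> d!(i+2) \<and> finite (d!(i+2) - d!i)) \<and>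
     (1 < length d \<longrightarrow> finite (d!1)) \<and>
     (\<forall>k. 1 \<le> k \<and> 2*k < length d \<longrightarrow> cogent_as R (d!(2*k)) (d!(2*k-1))) \<and>
     (\<forall>k. 2*k+1 < length d \<longrightarrow> \<not> cogent_as R (d!(2*k)) (d!(2*k+1)))"

definition ten_dispute :: "'a set \<Rightarrow> ('a \<times> 'a) set \<Rightarrow> 'a set list \<Rightarrow> bool" where
  "ten_dispute F R d \<longleftrightarrow> d \<noteq> [] \<and>
     (\<forall>i<length d. d!i \<subseteq> F \<and> cf R (d!i)) \<and>
     (\<forall>i. i + 2 < length d \<longrightarrow> d!i \<subseteq> d!(i+2) \<and> finite (d!(i+2) - d!i)) \<and>
     (1 < length d \<longrightarrow> finite (d!1)) \<and>
     (\<forall>i. i+1 < length d \<longrightarrow> cogent_as R (d!(i+1)) (d!i)) \<and>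
     (\<forall>k. 2*k+1 < length d \<longrightarrow> strictly_cogent R (d!(2*k+1)) (d!(2*k)))"

text \<open>A Pro strategy maps a dispute ending with an Opp move to Pro's next set.
  A dispute follows s if every Pro move X_{2k}, k \<ge> 1, is s applied to the
  preceding history.\<close>
definition follows :: "('a set list \<Rightarrow> 'a set) \<Rightarrow> 'a set list \<Rightarrow> bool" where
  "follows s d \<longleftrightarrow> (\<forall>k. 1 \<le> k \<and> 2*k < length d \<longrightarrow> d!(2*k) = s (take (2*k) d))"

text \<open>Pro's strategy s wins from A in the game with legality predicate legal iff
  the initial dispute (A) is legal and, whenever Opp has just moved in a legal
  dispute from A following s, Pro's answer according to s is a legal extension.
  Hence every concluded dispute following s ends with a Pro move (infinite
  plays count as Pro wins).\<close>
definition pro_wins :: "('a set list \<Rightarrow> bool) \<Rightarrow> 'a set \<Rightarrow> ('a set list \<Rightarrow> 'a set) \<Rightarrow> bool" where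
  "pro_wins legal A s \<longleftrightarrow> legal [A] \<and>
     (\<forall>d. legal d \<and> hd d = A \<and> follows s d \<and> even (length d) \<longrightarrow> legal (d @ [s d]))"

definition strongly_tenable :: "'a set \<Rightarrow> ('a \<times> 'a) set \<Rightarrow> 'a set \<Rightarrow> bool" where
  "strongly_tenable F R A \<longleftrightarrow> (\<exists>s. pro_wins (strong_dispute F R) A s)"

definition tenable :: "'a set \<Rightarrow> ('a \<times> 'a) set \<Rightarrow> 'a set \<Rightarrow> bool" where
  "tenable F R A \<longleftrightarrow> (\<exists>s. pro_wins (ten_dispute F R) A s)"

datatype sem = Cog | CyCog | WAd | WC | StrTen | Ten | StaTen

fun ext :: "sem \<Rightarrow> 'a set \<Rightarrow> ('a \<times> 'a) set \<Rightarrow> 'a set set" where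
  "ext Cog F R = {E. cogent F R E}"
| "ext CyCog F R = {E. cyc_cogent F R E}"
| "ext WAd F R = {E. wadm F R E}"
| "ext WC F R = {E. weakly_complete F R E}"
| "ext StrTen F R = {E. strongly_tenable F R E}"
| "ext Ten F R = {E. tenable F R E}"
| "ext StaTen F R = {E. stat_tenable F R E}"

definition solid :: "(sem \<times> sem) set" where
  "solid = {(Cog, CyCog), (Cog, WAd), (Cog, StrTen), (StrTen, Ten), (Ten, StaTen)}"

definition dashed :: "(sem \<times> sem) set" where
  "dashed = {(StaTen, WC), (WAd, WC)}"

end

theory Submission
  imports Defs
begin

text \<open>
  If \<open>E\<close> is cogent and \<open>B\<close> is conflict-free, then \<open>B - E\<^sup>+ \<succeq> E\<close>, hence \<open>E \<succeq> B\<close>. So a cogent set beats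
  every conflict-free set, and Opp has no first move against it. Removing from an opposing set the
  arguments already attacked by \<open>A\<close> turns any serious challenge into a legal first move of the
  tenability game, which makes tenable sets statically tenable. Statically tenable and weakly
  admissible sets both stay so when an argument unattacked in the reduct is added; a maximal one
  thus has no such argument, which is exactly weak completeness.

  For the negative part, a separation of \<open>\<sigma>\<close> from \<open>\<tau>\<close> transfers to every semantics reachable
  from \<open>\<sigma>\<close> and every semantics from which \<open>\<tau>\<close> is reachable, so seven separations, given by five frameworks with at most six arguments,
  yield all of (ii). Part (iii) needs in addition only the empty set in a framework without attacks.
\<close>

text \<open>As a rewrite rule, the recursive equation can unfold itself again and again.\<close>

declare wadm.simps [simp del]

abbreviation restrict :: "('a \<times> 'a) set \<Rightarrow> 'a set \<Rightarrow> ('a \<times> 'a) set" where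
  "restrict R G \<equiv> R \<inter> (G \<times> G)"

subsection \<open>Cogency and weak admissibility\<close>

lemma cogent_cogent_as:
  assumes "cogent F R E" "B \<subseteq> F" "cf R B"
  shows "cogent_as R E B"
proof -
  \<comment> \<open>Dropping what \<open>E\<close> attacks makes \<open>?D\<close> \<succeq>
    \<open>E\<close> vacuous; the dropped arguments are already countered by
    \<open>E\<close>.\<close>
  let ?D = "B - plus R E"
  have "cogent_as R ?D E"
    using assms(3) by (auto simp: cogent_as_def cf_def attacks_def plus_def)
  then have "cogent_as R E ?D"
    using assms(1,2) unfolding cogent_def by blast
  then show ?thesis
    by (auto simp: cogent_as_def)
qed

lemma cogent_cf: "cogent F R E \<Longrightarrow> cf R E"
  using cogent_cogent_as[of F R E "{}"] by (simp add: cogent_as_def cf_def)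

text \<open>The case \<open>A = {}\<close> is absorbed: nothing attacks the empty set, so the
  general condition is vacuous there.\<close>

lemma wadm_iff:
  "wadm F R A \<longleftrightarrow> finite F \<and> A \<subseteq> F \<and> cf R A \<and>
     (\<forall>y\<in>F. attacks R y A \<longrightarrow>
        (\<forall>B. wadm (reduct_args F R A) (restrict R (reduct_args F R A)) B \<longrightarrow> y \<notin> B))"
  by (subst wadm.simps) (auto simp: cf_def attacks_def)

lemma wadm_subset: "wadm F R A \<Longrightarrow> A \<subseteq> F"
  using wadm_iff by metis

lemma wadm_cf: "wadm F R A \<Longrightarrow> cf R A"
  using wadm_iff by metis

lemma wadm_not_attacked:
  assumes "wadm F R A" "wadm (reduct_args F R A) (restrict R (reduct_args F R A)) B" "y \<in> B"
  shows "\<not> attacks R y A"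
proof -
  have "y \<in> F"
    using wadm_subset[OF assms(2)] assms(3) by (auto simp: reduct_args_def)
  then show ?thesis
    using assms wadm_iff[of F R A] by blast
qed

text \<open>Classical admissibility suffices: a counterattacked attacker is deleted from the reduct,
  hence lies in no subset of it.\<close>

lemma admissible_imp_wadm:
  assumes "finite F" "A \<subseteq> F" "cf R A" "\<And>y. y \<in> F \<Longrightarrow> attacks R y A \<Longrightarrow> y \<in> plus R A"
  shows "wadm F R A"
proof -
  have "y \<notin> B"
    if "y \<in> F" "attacks R y A" "wadm (reduct_args F R A) (restrict R (reduct_args F R A)) B" for y B
    using wadm_subset[OF that(3)] assms(4)[OF that(1,2)] by (auto simp: reduct_args_def)
  then show ?thesis
    using assms(1-3) by (subst wadm_iff) blast
qed

text \<open>A weakly admissible \<open>B\<close> of the reduct is conflict-free for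
  \<open>R\<close>, so \<open>E\<close> \<succeq> \<open>B\<close>. An attacker of \<open>E\<close>
  in \<open>B\<close> would be attacked by \<open>E\<close>, but the reduct contains no such
  argument.\<close>

lemma cogent_imp_wadm:
  assumes "finite F" "cogent F R E"
  shows "wadm F R E"
proof -
  have "y \<notin> B"
    if "attacks R y E" "wadm (reduct_args F R E) (restrict R (reduct_args F R E)) B" for y B
  proof
    assume "y \<in> B"
    have B: "B \<subseteq> reduct_args F R E"
      using wadm_subset[OF that(2)] .
    have "cf R B"
      using wadm_cf[OF that(2)] B by (auto simp: cf_def)
    then have "cogent_as R E B"
      using cogent_cogent_as[OF assms(2)] B by (auto simp: reduct_args_def)
    then show False
      using \<open>y \<in> B\<close> B that(1) by (auto simp: cogent_as_def reduct_args_def)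
  qed
  then show ?thesis
    using assms cogent_cf[OF assms(2)] by (subst wadm_iff) (auto simp: cogent_def)
qed

text \<open>Collapsing iterated reducts allows comparing \<open>wadm\<close> at different depths of
  its recursion.\<close>

lemma reduct_args_reduct_args:
  assumes "B \<subseteq> reduct_args F R A"
  shows "reduct_args (reduct_args F R A) (restrict R (reduct_args F R A)) B = reduct_args F R (A \<union> B)"
proof -
  let ?G = "reduct_args F R A"
  have "plus (restrict R ?G) B = plus R B \<inter> ?G"
    using assms by (auto simp: plus_def)
  moreover have "plus R (A \<union> B) = plus R A \<union> plus R B"
    by (auto simp: plus_def)
  ultimately show ?thesis
    by (auto simp: reduct_args_def)
qed

lemma restrict_reduct_args:
  "reduct_args F R A \<subseteq> G \<Longrightarrow> restrict (restrict R G) (reduct_args F R A) = restrict R (reduct_args F R A)"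
  by auto

text \<open>As \<open>x\<close> is unattacked, an attacker of \<open>insert x W\<close> inside
  \<open>?H\<close> must attack \<open>W\<close>. The reduct by \<open>insert x W\<close> is the
  reduct of \<open>?H\<close> by \<open>W\<close>, so the weak admissibility of \<open>W\<close> in
  \<open>?H\<close> applies to it.\<close>

lemma wadm_insert_unattacked:
  assumes x: "x \<in> G" "\<And>y. y \<in> G \<Longrightarrow> (y, x) \<notin> R"
    and W: "wadm (reduct_args G R {x}) (restrict R (reduct_args G R {x})) W"
    and "finite G"
  shows "wadm G R (insert x W)"
proof -
  let ?H = "reduct_args G R {x}"
  let ?K = "reduct_args G R (insert x W)"
  have WH: "W \<subseteq> ?H"
    using wadm_subset[OF W] .
  have cfW: "cf R W"
    using wadm_cf[OF W] WH by (auto simp: cf_def)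
  have WG: "W \<subseteq> G" and xW: "\<And>w. w \<in> W \<Longrightarrow> (x, w) \<notin> R"
    using WH by (auto simp: reduct_args_def plus_def)
  have "cf R (insert x W)"
    using cfW x WG xW by (auto simp: cf_def)
  moreover have K: "reduct_args ?H (restrict R ?H) W = ?K"
    using reduct_args_reduct_args[OF WH] by simp
  have KH: "?K \<subseteq> ?H"
    by (auto simp: reduct_args_def plus_def)
  have "z \<notin> B"
    if "z \<in> G" "attacks R z (insert x W)" "wadm ?K (restrict R ?K) B" for z B
  proof
    assume "z \<in> B"
    then have "z \<in> ?H"
      using KH wadm_subset[OF that(3)] by blast
    then have "attacks (restrict R ?H) z W"
      using that(1,2) x WH by (auto simp: attacks_def)
    moreover have "wadm (reduct_args ?H (restrict R ?H) W)
        (restrict (restrict R ?H) (reduct_args ?H (restrict R ?H) W)) B"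
      using that(3) K restrict_reduct_args[OF KH] by simp
    ultimately show False
      using wadm_not_attacked[OF W] \<open>z \<in> B\<close> by blast
  qed
  ultimately show ?thesis
    using \<open>finite G\<close> x(1) WG by (subst wadm_iff) blast
qed

text \<open>The weak admissibility of \<open>A\<close> is used twice: against \<open>{x}\<close>, so
  that \<open>x\<close> does not attack \<open>A\<close>, and against \<open>insert x W\<close> for
  \<open>W\<close> weakly admissible in the smaller reduct, so that no element of \<open>W\<close>
  attacks \<open>A\<close>.\<close>

lemma wadm_insert:
  assumes A: "wadm F R A" and x: "x \<in> reduct_args F R A"
    and unatt: "\<And>y. y \<in> reduct_args F R A \<Longrightarrow> (y, x) \<notin> R"
  shows "wadm F R (insert x A)"
proof -
  let ?G = "reduct_args F R A"
  let ?H = "reduct_args F R (insert x A)"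
  have fin: "finite F" "finite ?G"
    using A wadm_iff[of F R A] by (auto simp: reduct_args_def)
  have "wadm ?G (restrict R ?G) {x}"
    by (rule admissible_imp_wadm) (use fin x unatt in \<open>auto simp: cf_def attacks_def\<close>)
  then have "\<not> attacks R x A"
    using wadm_not_attacked[OF A] by blast
  then have "cf R (insert x A)"
    using wadm_cf[OF A] x unatt by (auto simp: cf_def attacks_def reduct_args_def plus_def)
  moreover have H: "reduct_args ?G (restrict R ?G) {x} = ?H"
    using reduct_args_reduct_args[of "{x}" F R A] x by simp
  have HG: "?H \<subseteq> ?G"
    by (auto simp: reduct_args_def plus_def)
  have "y \<notin> W" if "attacks R y (insert x A)" "wadm ?H (restrict R ?H) W" for y W
  proof
    assume "y \<in> W"
    then have "y \<in> ?G"
      using wadm_subset[OF that(2)] HG by blast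
    then have "attacks R y A"
      using that(1) unatt by (auto simp: attacks_def)
    moreover have "wadm ?G (restrict R ?G) (insert x W)"
      by (rule wadm_insert_unattacked)
        (use x unatt fin that(2) in \<open>simp_all add: H restrict_reduct_args[OF HG]\<close>)
    ultimately show False
      using wadm_not_attacked[OF A] \<open>y \<in> W\<close> by blast
  qed
  ultimately show ?thesis
    using fin wadm_subset[OF A] x by (subst wadm_iff) (auto simp: reduct_args_def)
qed

text \<open>Refutes weak admissibility without descending into the recursion: an admissible set of
  the reduct containing an attacker is enough.\<close>

lemma not_wadmI:
  assumes "y \<in> B" "attacks R y A" "B \<subseteq> reduct_args F R A" "cf R B"
    and "\<And>z. z \<in> reduct_args F R A \<Longrightarrow> attacks R z B \<Longrightarrow> z \<in> plus R B"
  shows "\<not> wadm F R A"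
proof
  assume A: "wadm F R A"
  let ?G = "reduct_args F R A"
  have "finite F"
    using A wadm_iff[of F R A] by blast
  then have "finite ?G"
    by (simp add: reduct_args_def)
  moreover have "z \<in> plus (restrict R ?G) B" if "z \<in> ?G" "attacks (restrict R ?G) z B" for z
  proof -
    have "attacks R z B"
      using that by (auto simp: attacks_def)
    then show ?thesis
      using assms(5)[OF that(1)] that(1) assms(3) by (auto simp: plus_def)
  qed
  ultimately have "wadm ?G (restrict R ?G) B"
    using assms(3,4) by (intro admissible_imp_wadm) (auto simp: cf_def)
  then show False
    using wadm_not_attacked[OF A] assms(1,2) by blast
qed

subsection \<open>Extending to a weakly complete set\<close>

lemma weakly_completeI:
  assumes "A \<subseteq> F" "cf R A"
    and "\<And>x. x \<in> reduct_args F R A \<Longrightarrow> \<exists>y\<in>reduct_args F R A. (y, x) \<in> R"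
  shows "weakly_complete F R A"
proof -
  \<comment> \<open>The third assumption supplies an \<open>Undec\<close> attacker for each argument
    that this labeling leaves \<open>Undec\<close>.\<close>
  let ?L = "\<lambda>a. if a \<in> A then In else if a \<in> plus R A then Out else Undec"
  have "A = {a \<in> F. ?L a = In}"
    using assms(1) by auto
  moreover have "wc_labeling F R ?L"
    unfolding wc_labeling_def
  proof (intro ballI conjI impI)
    fix a assume "a \<in> F"
    show "\<not> (\<exists>b\<in>F. (b, a) \<in> R \<and> ?L b = In)" if "?L a = In"
      using that assms(2) by (auto simp: cf_def split: if_splits)
    show "\<exists>b\<in>F. (b, a) \<in> R \<and> ?L b = In" if "?L a = Out"
      using that assms(1) by (fastforce simp: plus_def split: if_splits)
    show "\<exists>b\<in>F. (b, a) \<in> R \<and> ?L b = Undec" if "?L a = Undec"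
      using that assms(3)[of a] \<open>a \<in> F\<close> by (auto simp: reduct_args_def split: if_splits)
    show "\<not> (\<exists>b\<in>F. (b, a) \<in> R \<and> ?L b = In)" if "?L a = Undec"
      using that by (auto simp: plus_def split: if_splits)
  qed
  ultimately show ?thesis
    unfolding weakly_complete_def by blast
qed

text \<open>\<open>P\<close> is abstract so that one maximality argument serves both static
  tenability and weak admissibility.\<close>

lemma ex_weakly_complete_superset:
  assumes "finite F" "P A"
    and P: "\<And>B. P B \<Longrightarrow> B \<subseteq> F \<and> cf R B"
    and ins: "\<And>B x. P B \<Longrightarrow> x \<in> reduct_args F R B \<Longrightarrow>
        (\<And>y. y \<in> reduct_args F R B \<Longrightarrow> (y, x) \<notin> R) \<Longrightarrow> P (insert x B)"
  shows "\<exists>B. weakly_complete F R B \<and> A \<subseteq> B"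
proof -
  have "finite {B. P B}"
    using P assms(1) by (auto intro: finite_subset[of _ "Pow F"])
  then obtain M where M: "P M" "A \<subseteq> M" "\<And>B. P B \<Longrightarrow> M \<subseteq> B \<Longrightarrow> M = B"
    using finite_has_maximal2[of "{B. P B}" A] assms(2) by auto
  have "weakly_complete F R M"
  proof (rule weakly_completeI)
    fix x assume x: "x \<in> reduct_args F R M"
    show "\<exists>y\<in>reduct_args F R M. (y, x) \<in> R"
    proof (rule ccontr)
      assume "\<not> ?thesis"
      then have "P (insert x M)"
        using ins[OF M(1) x] by blast
      then have "x \<in> M"
        using M(3) by blast
      then show False
        using x by (simp add: reduct_args_def)
    qed
  qed (use P M(1) in auto)
  then show ?thesis
    using M(2) by blast
qed

lemma stat_tenableE:
  assumes "stat_tenable F R A" "B \<subseteq> F" "finite B" "cf R B"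
  obtains C where "C \<subseteq> F" "cf R C" "A \<subseteq> C" "cogent_as R C B"
  using assms unfolding stat_tenable_def by blast

text \<open>Conflict-freeness is inherited from an answer to the empty opposing set.\<close>

lemma stat_tenable_cf:
  assumes "stat_tenable F R A"
  shows "cf R A"
proof -
  obtain C where "cf R C" "A \<subseteq> C"
    by (rule stat_tenableE[OF assms, of "{}"]) (simp_all add: cf_def)
  then show ?thesis
    by (auto simp: cf_def)
qed

lemma stat_tenable_insert:
  assumes AF: "AF F R" and A: "stat_tenable F R A" and x: "x \<in> reduct_args F R A"
    and unatt: "\<And>y. y \<in> reduct_args F R A \<Longrightarrow> (y, x) \<notin> R"
  shows "stat_tenable F R (insert x A)"
  unfolding stat_tenable_def
proof (intro conjI allI impI)
  show "insert x A \<subseteq> F"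
    using A x by (auto simp: stat_tenable_def reduct_args_def)
  \<comment> \<open>\<open>AF F R\<close> places each attacker of \<open>x\<close> in
    \<open>F\<close>; it lies neither in \<open>A\<close> nor in the reduct, so \<open>A\<close>
    attacks it.\<close>
  have att: "y \<in> plus R A" if "(y, x) \<in> R" for y
  proof -
    have "y \<in> F" "y \<notin> A"
      using that AF x by (auto simp: AF_def reduct_args_def plus_def)
    then show ?thesis
      using that unatt[of y] by (auto simp: reduct_args_def)
  qed
  have xF: "x \<in> F" and xx: "(x, x) \<notin> R"
    using x unatt by (auto simp: reduct_args_def)
  fix B assume B: "B \<subseteq> F \<and> finite B \<and> cf R B"
  \<comment> \<open>Adding \<open>x\<close> to the opposing set forces the answer to be consistent with \<open>x\<close>:
    all attackers of \<open>x\<close> lie in \<open>A\<^sup>+\<close>, so \<open>x\<close> cannot be countered.\<close>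
  let ?B = "insert x (B - plus R {x} - plus R A)"
  have "?B \<subseteq> F" "finite ?B" "cf R ?B"
    using B xF xx att by (auto simp: cf_def plus_def)
  then obtain C where C: "C \<subseteq> F" "cf R C" "A \<subseteq> C" "cogent_as R C ?B"
    by (rule stat_tenableE[OF A])
  have xC: "x \<notin> plus R C"
    using att C(2,3) by (fastforce simp: plus_def cf_def)
  then have "\<not> attacks R x C"
    using C(4) by (auto simp: cogent_as_def)
  then have cf: "cf R (insert x C)"
    using C(2) xC xx by (auto simp: cf_def attacks_def plus_def)
  moreover have "cogent_as R (insert x C) B"
    unfolding cogent_as_def
  proof (intro conjI ballI impI)
    fix b assume b: "b \<in> B" "attacks R b (insert x C)"
    show "b \<in> plus R (insert x C)"
    \<comment> \<open>The members removed from \<open>B\<close> are countered by \<open>x\<close> or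
      by \<open>A\<close>.\<close>
    proof (cases "b \<in> plus R {x} \<or> b \<in> plus R A")
      case True
      then show ?thesis
        using C(3) by (auto simp: plus_def)
    next
      case False
      then have "attacks R b C"
        using b(2) att by (auto simp: attacks_def)
      then have "b \<in> plus R C"
        using C(4) b(1) False by (auto simp: cogent_as_def)
      then show ?thesis
        by (auto simp: plus_def)
    qed
  qed (rule cf)
  ultimately show "\<exists>C. C \<subseteq> F \<and> cf R C \<and> insert x A \<subseteq> C \<and> cogent_as R C B"
    using C(1,3) xF by (intro exI[of _ "insert x C"]) auto
qed

subsection \<open>The two dispute games\<close>

text \<open>Both games have the same Pro moves; they differ only in the condition \<open>Q P X\<close> under which
  Opp may answer \<open>P\<close> with \<open>X\<close>.\<close>

definition dispute ::
    "('a set \<Rightarrow> 'a set \<Rightarrow> bool) \<Rightarrow> 'a set \<Rightarrow> ('a \<times> 'a) set \<Rightarrow> 'a set list \<Rightarrow> bool" where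
  "dispute Q F R d \<longleftrightarrow> d \<noteq> [] \<and>
     (\<forall>i<length d. d!i \<subseteq> F \<and> cf R (d!i)) \<and>
     (\<forall>i. i + 2 < length d \<longrightarrow> d!i \<subseteq> d!(i+2) \<and> finite (d!(i+2) - d!i)) \<and>
     (1 < length d \<longrightarrow> finite (d!1)) \<and>
     (\<forall>k. 1 \<le> k \<and> 2*k < length d \<longrightarrow> cogent_as R (d!(2*k)) (d!(2*k-1))) \<and>
     (\<forall>k. 2*k+1 < length d \<longrightarrow> Q (d!(2*k)) (d!(2*k+1)))"

lemma strong_dispute_eq: "strong_dispute F R = dispute (\<lambda>P X. \<not> cogent_as R P X) F R"
  by (simp add: fun_eq_iff strong_dispute_def dispute_def)

text \<open>The cogency clause splits by parity: for even \<open>i\<close> it is part of the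
  strictness of Opp's move, for odd \<open>i\<close> it is the clause on Pro moves.\<close>

lemma ten_dispute_eq: "ten_dispute F R = dispute (\<lambda>P X. strictly_cogent R X P) F R"
proof
  fix d
  have "(\<forall>i. i+1 < length d \<longrightarrow> cogent_as R (d!(i+1)) (d!i)) \<longleftrightarrow>
      (\<forall>k. 1 \<le> k \<and> 2*k < length d \<longrightarrow> cogent_as R (d!(2*k)) (d!(2*k-1)))"
    (is "?L \<longleftrightarrow> ?R")
    if odd: "\<forall>k. 2*k+1 < length d \<longrightarrow> strictly_cogent R (d!(2*k+1)) (d!(2*k))"
  proof
    assume L: ?L
    show ?R
    proof (intro allI impI)
      fix k assume "1 \<le> k \<and> 2*k < length d"
      then show "cogent_as R (d!(2*k)) (d!(2*k-1))"
        using L[rule_format, of "2*k-1"] by simp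
    qed
  next
    assume R: ?R
    show ?L
    proof (intro allI impI)
      fix i assume i: "i+1 < length d"
      show "cogent_as R (d!(i+1)) (d!i)"
      proof (cases "even i")
        case True
        then obtain k where "i = 2*k" by (auto elim: evenE)
        then show ?thesis
          using odd i by (simp add: strictly_cogent_def)
      next
        case False
        then obtain k where "i = 2*k+1" by (auto elim: oddE)
        then show ?thesis
          using R[rule_format, of "k+1"] i by simp
      qed
    qed
  qed
  then show "ten_dispute F R d = dispute (\<lambda>P X. strictly_cogent R X P) F R d"
    unfolding ten_dispute_def dispute_def by blast
qed

lemma dispute_singleton: "dispute Q F R [A] \<longleftrightarrow> A \<subseteq> F \<and> cf R A"
  by (auto simp: dispute_def)

text \<open>Only the instances at the new index have to be checked. Even length means that Opp moved
  last, so \<open>X\<close> is a Pro move.\<close>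

lemma dispute_snoc:
  assumes "dispute Q F R d"
  shows "dispute Q F R (d @ [X]) \<longleftrightarrow> X \<subseteq> F \<and> cf R X \<and>
     (2 \<le> length d \<longrightarrow> d!(length d - 2) \<subseteq> X \<and> finite (X - d!(length d - 2))) \<and>
     (length d = 1 \<longrightarrow> finite X) \<and>
     (if even (length d) then cogent_as R X (last d) else Q (last d) X)"
proof -
  let ?n = "length d"
  have "d \<noteq> []"
    using assms by (simp add: dispute_def)
  then have last: "last d = d!(?n - 1)" and n: "?n \<noteq> 0"
    by (auto simp: last_conv_nth)
  have "(\<forall>i<length (d @ [X]). (d @ [X])!i \<subseteq> F \<and> cf R ((d @ [X])!i)) \<longleftrightarrow> X \<subseteq> F \<and> cf R X"
    using assms by (auto simp: dispute_def nth_append less_Suc_eq)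
  moreover have "(\<forall>i. i + 2 < length (d @ [X]) \<longrightarrow>
        (d @ [X])!i \<subseteq> (d @ [X])!(i+2) \<and> finite ((d @ [X])!(i+2) - (d @ [X])!i)) \<longleftrightarrow>
      (2 \<le> ?n \<longrightarrow> d!(?n - 2) \<subseteq> X \<and> finite (X - d!(?n - 2)))" (is "?L \<longleftrightarrow> ?R")
  proof
    assume L: ?L
    show ?R
    proof
      assume "2 \<le> ?n"
      then obtain m where "?n = m + 2"
        using le_Suc_ex by (metis add.commute)
      then show "d!(?n - 2) \<subseteq> X \<and> finite (X - d!(?n - 2))"
        using L[rule_format, of m] by (simp add: nth_append)
    qed
  next
    assume R: ?R
    show ?L
    proof (intro allI impI)
      fix i assume "i + 2 < length (d @ [X])"
      then consider "i + 2 < ?n" | "i = ?n - 2" "2 \<le> ?n" by force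
      then show "(d @ [X])!i \<subseteq> (d @ [X])!(i+2) \<and> finite ((d @ [X])!(i+2) - (d @ [X])!i)"
        using assms R by cases (auto simp: dispute_def nth_append)
    qed
  qed
  moreover have "(1 < length (d @ [X]) \<longrightarrow> finite ((d @ [X])!1)) \<longleftrightarrow> (?n = 1 \<longrightarrow> finite X)"
  proof (cases "?n = 1")
    case False
    then have "1 < ?n"
      using n by linarith
    then show ?thesis
      using assms by (simp add: dispute_def nth_append)
  qed (simp add: nth_append)
  moreover have "(\<forall>k. 1 \<le> k \<and> 2*k < length (d @ [X]) \<longrightarrow>
        cogent_as R ((d @ [X])!(2*k)) ((d @ [X])!(2*k-1))) \<longleftrightarrow>
      (even ?n \<longrightarrow> cogent_as R X (last d))" (is "?L \<longleftrightarrow> ?R")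
  proof
    assume L: ?L
    show ?R
    proof
      assume "even ?n"
      then obtain k where "?n = 2*k"
        by (rule evenE)
      then show "cogent_as R X (last d)"
        using L[rule_format, of k] n by (simp add: nth_append last)
    qed
  next
    assume R: ?R
    show ?L
    proof (intro allI impI)
      fix k assume "1 \<le> k \<and> 2*k < length (d @ [X])"
      then consider "1 \<le> k" "2*k < ?n" | "?n = 2*k" "1 \<le> k" by force
      then show "cogent_as R ((d @ [X])!(2*k)) ((d @ [X])!(2*k-1))"
      proof cases
        case 1
        then have "2*k - 1 < ?n"
          by linarith
        then show ?thesis
          using assms 1 by (simp add: dispute_def nth_append)
      next
        case 2
        then show ?thesis
          using R by (simp add: nth_append last)
      qed
    qed
  qed
  moreover have "(\<forall>k. 2*k+1 < length (d @ [X]) \<longrightarrow> Q ((d @ [X])!(2*k)) ((d @ [X])!(2*k+1))) \<longleftrightarrow>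
      (odd ?n \<longrightarrow> Q (last d) X)" (is "?L \<longleftrightarrow> ?R")
  proof
    assume L: ?L
    show ?R
    proof
      assume "odd ?n"
      then obtain k where "?n = 2*k+1"
        by (rule oddE)
      then show "Q (last d) X"
        using L[rule_format, of k] by (simp add: nth_append last)
    qed
  next
    assume R: ?R
    show ?L
    proof (intro allI impI)
      fix k assume "2*k+1 < length (d @ [X])"
      then consider "2*k+1 < ?n" | "?n = 2*k+1" by force
      then show "Q ((d @ [X])!(2*k)) ((d @ [X])!(2*k+1))"
        using assms R by cases (simp_all add: dispute_def nth_append last)
    qed
  qed
  ultimately show ?thesis
    unfolding dispute_def[of Q F R "d @ [X]"] by auto
qed

text \<open>A sufficient condition for winning: some answer to each first Opp move leaves Opp
  without a second move.\<close>

lemma pro_wins_one_round: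
  assumes A: "finite F" "A \<subseteq> F" "cf R A"
    and ans: "\<And>B. B \<subseteq> F \<Longrightarrow> cf R B \<Longrightarrow> Q A B \<Longrightarrow>
      \<exists>C. A \<subseteq> C \<and> C \<subseteq> F \<and> cogent_as R C B \<and> (\<forall>D. B \<subseteq> D \<and> D \<subseteq> F \<and> cf R D \<longrightarrow> \<not> Q C D)"
  shows "\<exists>s. pro_wins (dispute Q F R) A s"
proof -
  let ?good = "\<lambda>B C. A \<subseteq> C \<and> C \<subseteq> F \<and> cogent_as R C B \<and> (\<forall>D. B \<subseteq> D \<and> D \<subseteq> F \<and> cf R D \<longrightarrow> \<not> Q C D)"
  \<comment> \<open>The strategy looks only at Opp's first move, so it returns the same set on
    \<open>take 2 d\<close> and on \<open>d\<close>.\<close>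
  define s where "s d = (SOME C. ?good (d!1) C)" for d
  have "dispute Q F R (d @ [s d])"
    if d: "dispute Q F R d" "hd d = A" "follows s d" "even (length d)" for d
  proof -
    have len: "2 \<le> length d"
      using d(1,4) by (cases d; cases "tl d") (auto simp: dispute_def)
    have d0: "d!0 = A"
      using d(1,2) by (simp add: dispute_def hd_conv_nth)
    have d1: "d!1 \<subseteq> F" "cf R (d!1)" "Q A (d!1)"
    proof -
      show "d!1 \<subseteq> F" "cf R (d!1)"
        using d(1) len unfolding dispute_def by simp_all
      show "Q A (d!1)"
        using d(1) len d0 unfolding dispute_def by (elim conjE) (drule spec[of _ 0], simp)
    qed
    have good: "?good (d!1) (s d)"
      unfolding s_def using someI_ex[OF ans[OF d1]] .
    have "length d = 2"
    proof (rule ccontr)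
      assume "length d \<noteq> 2"
      then have 4: "3 < length d"
        using len d(4) by (cases "length d = 3") auto
      then have "d!2 = s (take 2 d)"
        using d(3)[unfolded follows_def, rule_format, of 1] by simp
      also have "\<dots> = s d"
        by (simp add: s_def)
      finally have "d!2 = s d" .
      moreover have "d!1 \<subseteq> d!3"
        using d(1) 4 unfolding dispute_def
        by (elim conjE) (drule spec[of _ 1], simp add: numeral_3_eq_3 numeral_2_eq_2)
      moreover have "d!3 \<subseteq> F \<and> cf R (d!3)"
        using d(1) 4 unfolding dispute_def by blast
      moreover have "Q (d!2) (d!3)"
        using d(1) 4 unfolding dispute_def
        by (elim conjE) (drule spec[of _ 1], simp add: numeral_3_eq_3 numeral_2_eq_2)
      ultimately show False
        using good by metis
    qed
    moreover have "last d = d!1"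
      using \<open>length d = 2\<close> by (cases d) (auto simp: last_conv_nth)
    ultimately show ?thesis
      using dispute_snoc[OF d(1)] good d0 A(1)
      by (auto simp: cogent_as_def intro: finite_subset)
  qed
  then have "pro_wins (dispute Q F R) A s"
    using A by (simp add: pro_wins_def dispute_singleton)
  then show ?thesis
    by blast
qed

text \<open>Reads off the first two answers of a winning strategy. In a finite \<open>F\<close> the
  finiteness clauses of the game hold automatically.\<close>

lemma pro_wins_two_rounds:
  assumes A: "pro_wins (dispute Q F R) A s" and "finite F"
    and B: "B \<subseteq> F" "cf R B" "Q A B"
  obtains C where "A \<subseteq> C" "C \<subseteq> F" "cogent_as R C B"
    "\<And>D. B \<subseteq> D \<Longrightarrow> D \<subseteq> F \<Longrightarrow> cf R D \<Longrightarrow> Q C D \<Longrightarrow> \<exists>E. C \<subseteq> E \<and> E \<subseteq> F \<and> cogent_as R E D"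
proof -
  let ?C = "s [A, B]"
  have fin: "finite X" if "X \<subseteq> F" for X
    using that \<open>finite F\<close> by (rule finite_subset)
  have dA: "dispute Q F R [A]"
    and step: "\<And>d. \<lbrakk>dispute Q F R d; hd d = A; follows s d; even (length d)\<rbrakk> \<Longrightarrow> dispute Q F R (d @ [s d])"
    using A by (auto simp: pro_wins_def)
  have dB: "dispute Q F R [A, B]"
    using dispute_snoc[OF dA, of B] B fin by simp
  have dC: "dispute Q F R [A, B, ?C]"
  proof -
    have "follows s [A, B]"
      by (auto simp: follows_def)
    then show ?thesis
      using step[OF dB] by simp
  qed
  then have C: "A \<subseteq> ?C" "?C \<subseteq> F" "cogent_as R ?C B"
    using dispute_snoc[OF dB, of ?C] by auto
  have "\<exists>E. ?C \<subseteq> E \<and> E \<subseteq> F \<and> cogent_as R E D" if D: "B \<subseteq> D" "D \<subseteq> F" "cf R D" "Q ?C D" for D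
  proof -
    have dD: "dispute Q F R [A, B, ?C, D]"
      using dispute_snoc[OF dC, of D] D fin by simp
    have "follows s [A, B, ?C, D]"
      unfolding follows_def
    proof (intro allI impI)
      fix k :: nat assume "1 \<le> k \<and> 2*k < length [A, B, ?C, D]"
      then have "k = 1" by auto
      then show "[A, B, ?C, D] ! (2*k) = s (take (2*k) [A, B, ?C, D])"
        by (simp add: numeral_2_eq_2)
    qed
    then have "dispute Q F R ([A, B, ?C, D] @ [s [A, B, ?C, D]])"
      using step[OF dD] by simp
    then show ?thesis
      using dispute_snoc[OF dD] by auto
  qed
  with C show ?thesis
    by (rule that)
qed

section \<open>Implications between the notions of tenability\<close>

lemma strongly_tenable_subset_cf: "strongly_tenable F R A \<Longrightarrow> A \<subseteq> F \<and> cf R A"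
  by (auto simp: strongly_tenable_def pro_wins_def strong_dispute_eq dispute_singleton)

lemma tenable_subset_cf: "tenable F R A \<Longrightarrow> A \<subseteq> F \<and> cf R A"
  by (auto simp: tenable_def pro_wins_def ten_dispute_eq dispute_singleton)

lemma cogent_imp_strongly_tenable:
  assumes "finite F" "cogent F R A"
  shows "strongly_tenable F R A"
  unfolding strongly_tenable_def strong_dispute_eq
  by (rule pro_wins_one_round)
    (use assms cogent_cf[OF assms(2)] cogent_cogent_as[OF assms(2)] in \<open>auto simp: cogent_def\<close>)

text \<open>The same strategy works: Opp has fewer moves in the tenability game, and Pro moves are
  legal under the same conditions.\<close>

lemma strongly_tenable_imp_tenable:
  assumes "strongly_tenable F R A"
  shows "tenable F R A"
proof -
  obtain s where s: "pro_wins (strong_dispute F R) A s"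
    using assms by (auto simp: strongly_tenable_def)
  have strong: "strong_dispute F R d" if "ten_dispute F R d" for d
    using that unfolding ten_dispute_eq strong_dispute_eq dispute_def strictly_cogent_def by blast
  have "ten_dispute F R (d @ [s d])"
    if d: "ten_dispute F R d" "hd d = A" "follows s d" "even (length d)" for d
  proof -
    have "strong_dispute F R (d @ [s d])"
      using s strong[OF d(1)] d(2-4) by (simp add: pro_wins_def)
    then show ?thesis
      using d(1,4) dispute_snoc[of _ F R d "s d"] strong[OF d(1)]
      by (simp add: ten_dispute_eq strong_dispute_eq)
  qed
  then have "pro_wins (ten_dispute F R) A s"
    using s by (simp add: pro_wins_def ten_dispute_eq strong_dispute_eq dispute_singleton)
  then show ?thesis
    by (auto simp: tenable_def)
qed

lemma tenable_imp_stat_tenable: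
  assumes "finite F" "tenable F R A"
  shows "stat_tenable F R A"
  unfolding stat_tenable_def
proof (intro conjI allI impI)
  show "A \<subseteq> F"
    using tenable_subset_cf[OF assms(2)] by blast
  fix B assume B: "B \<subseteq> F \<and> finite B \<and> cf R B"
  \<comment> \<open>\<open>A\<close> attacks nothing in \<open>?B\<close>, so \<open>?B\<close>
    \<succeq> \<open>A\<close>; unless \<open>A\<close> \<succeq> \<open>?B\<close>, this is a legal
    Opp move.\<close>
  let ?B = "B - plus R A"
  obtain C where C: "A \<subseteq> C" "C \<subseteq> F" "cogent_as R C ?B"
  proof (cases "cogent_as R A ?B")
    case True
    then show ?thesis
      using that[of A] \<open>A \<subseteq> F\<close> by blast
  next
    case False
    have cfB: "cf R ?B"
      using B by (auto simp: cf_def)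
    then have strict: "strictly_cogent R ?B A"
      using False by (auto simp: strictly_cogent_def cogent_as_def attacks_def plus_def)
    obtain s where s: "pro_wins (dispute (\<lambda>P X. strictly_cogent R X P) F R) A s"
      using assms(2) by (auto simp: tenable_def ten_dispute_eq)
    have "?B \<subseteq> F"
      using B by blast
    then show ?thesis
      using cfB strict by (rule pro_wins_two_rounds[OF s assms(1)]) (rule that)
  qed
  moreover have "plus R A \<subseteq> plus R C"
    using C(1) by (auto simp: plus_def)
  ultimately have "cogent_as R C B"
    unfolding cogent_as_def by blast
  then show "\<exists>C. C \<subseteq> F \<and> cf R C \<and> A \<subseteq> C \<and> cogent_as R C B"
    using C(1,2) by (auto simp: cogent_as_def)
qed

subsection \<open>Separating frameworks\<close>

text \<open>\<open>S\<close> is an invariant of ascending chains: one starting at the challenger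
  \<open>D\<close> stays in \<open>S\<close> and never reaches \<open>E\<close>.\<close>

lemma not_cyc_cogentI:
  assumes "D \<in> S" "D \<subseteq> F" "strictly_cogent R D E" "E \<notin> S"
    and S: "\<And>X Y. X \<in> S \<Longrightarrow> Y \<subseteq> F \<Longrightarrow> strictly_cogent R Y X \<Longrightarrow> Y \<in> S"
  shows "\<not> cyc_cogent F R E"
proof
  assume "cyc_cogent F R E"
  then have "(D, E) \<in> (prec_rel F R)\<^sup>+"
    using assms(2,3) unfolding cyc_cogent_def strictly_cogent_def by blast
  then have "E \<in> S"
    using \<open>D \<in> S\<close> by induction (auto simp: prec_rel_def intro: S)
  then show False
    using \<open>E \<notin> S\<close> by blast
qed

lemma strictly_cogentE:
  assumes "strictly_cogent R Y X" "cf R X"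
  obtains x y where "x \<in> X" "y \<in> Y" "(y, x) \<in> R" "y \<notin> plus R X"
  using assms unfolding strictly_cogent_def cogent_as_def attacks_def by blast

lemmas cogency_defs = strictly_cogent_def cogent_as_def cf_def attacks_def plus_def

text \<open>Compare with the empty set: both \<open>E\<close> \<succeq> \<open>{}\<close> and a
  chain ending in \<open>E\<close> make \<open>E\<close> conflict-free.\<close>

lemma cyc_cogent_subset_cf:
  assumes "cyc_cogent F R E"
  shows "E \<subseteq> F \<and> cf R E"
proof -
  have "cogent_as R {} E"
    by (simp add: cogency_defs)
  then have "cogent_as R E {} \<or> ({}, E) \<in> (prec_rel F R)\<^sup>+"
    using assms unfolding cyc_cogent_def by blast
  then have "cf R E"
    by (auto simp: cogent_as_def prec_rel_def strictly_cogent_def dest: tranclD2)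
  then show ?thesis
    using assms by (simp add: cyc_cogent_def)
qed

abbreviation cycle3 :: "(nat \<times> nat) set" where
  "cycle3 \<equiv> {(0, 1), (1, 2), (2, 0)}"

text \<open>The only strict challenger \<open>{2}\<close> leads back to \<open>{0}\<close> by
  \<open>{2}\<close> \<prec> \<open>{1}\<close> \<prec> \<open>{0}\<close>.\<close>

lemma cycle3_cyc_cogent: "cyc_cogent {0, 1, 2} cycle3 {0}"
proof -
  have 1: "({2}, {1}) \<in> prec_rel {0, 1, 2} cycle3"
    by (auto simp: prec_rel_def cogency_defs)
  have 2: "({1}, {0}) \<in> prec_rel {0, 1, 2} cycle3"
    by (auto simp: prec_rel_def cogency_defs)
  have "D = {2}"
    if "D \<in> Pow {0, 1, 2}" "cogent_as cycle3 D {0}" "\<not> cogent_as cycle3 {0} D" for D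
    using that by (auto simp: Pow_insert cogency_defs)
  moreover have "({2}, {0}) \<in> (prec_rel {0, 1, 2} cycle3)\<^sup>+"
    using 1 2 by (rule trancl.intros(2)[OF trancl.intros(1)])
  ultimately show ?thesis
    unfolding cyc_cogent_def by blast
qed

text \<open>If \<open>0\<close> is \<open>In\<close>, then \<open>1\<close> must be
  \<open>Out\<close>, and no label is left for \<open>2\<close>, which attacks \<open>0\<close> and
  is attacked only by \<open>1\<close>.\<close>

lemma cycle3_not_weakly_complete:
  assumes "weakly_complete {0, 1, 2} cycle3 B"
  shows "0 \<notin> B"
proof
  assume "0 \<in> B"
  then obtain L where "wc_labeling {0, 1, 2} cycle3 L" "L 0 = In"
    using assms by (auto simp: weakly_complete_def)
  then show False
    by (cases "L 1"; cases "L 2") (auto simp: wc_labeling_def)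
qed

text \<open>An odd cycle has no nonempty weakly admissible set, so its victim \<open>3\<close> is weakly admissible,
  but \<open>{3}\<close> is maximal conflict-free and cannot be defended.\<close>

abbreviation cycle3_out :: "(nat \<times> nat) set" where
  "cycle3_out \<equiv> {(0, 1), (1, 2), (2, 0), (0, 3), (1, 3), (2, 3)}"

text \<open>Any two distinct arguments are joined by an attack.\<close>

lemma cycle3_out_cf:
  assumes "B \<subseteq> {0, 1, 2, 3}" "cf cycle3_out B" "a \<in> B"
  shows "B = {a}"
proof -
  have "b = a" if "b \<in> B" for b
  proof -
    have "(a, b) \<notin> cycle3_out" "(b, a) \<notin> cycle3_out"
      using assms(2,3) that unfolding cf_def by blast+
    moreover have "a \<in> {0, 1, 2, 3}" "b \<in> {0, 1, 2, 3}"
      using assms(1,3) that by blast+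
    ultimately show ?thesis
      by auto
  qed
  then show ?thesis
    using assms(3) by blast
qed

lemma cycle3_out_wadm: "wadm {0, 1, 2, 3} cycle3_out {3}"
proof -
  have red: "reduct_args {0, 1, 2, 3} cycle3_out {3} = {0, 1, 2}"
    by (auto simp: reduct_args_def plus_def)
  have restr: "restrict cycle3_out {0, 1, 2} = cycle3"
    by auto
  have "B = {}" if B: "wadm {0, 1, 2} cycle3 B" for B
  proof -
    have "B \<in> Pow {0, 1, 2}"
      using wadm_subset[OF B] by simp
    then consider "B = {}" | "B = {0}" | "B = {1}" | "B = {2}"
      using wadm_cf[OF B] by (auto simp: Pow_insert cf_def)
    \<comment> \<open>Removing an argument of the cycle and its victim leaves only its attacker,
      which is then unattacked.\<close>
    moreover have "\<not> wadm {0, 1, 2} cycle3 {0}"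
      by (rule not_wadmI[of 2 "{2}"]) (auto simp: cf_def attacks_def reduct_args_def plus_def)
    moreover have "\<not> wadm {0, 1, 2} cycle3 {1}"
      by (rule not_wadmI[of 0 "{0}"]) (auto simp: cf_def attacks_def reduct_args_def plus_def)
    moreover have "\<not> wadm {0, 1, 2} cycle3 {2}"
      by (rule not_wadmI[of 1 "{1}"]) (auto simp: cf_def attacks_def reduct_args_def plus_def)
    ultimately show ?thesis
      using B by metis
  qed
  then show ?thesis
    by (subst wadm_iff) (auto simp only: red restr, auto simp: cf_def)
qed

lemma cycle3_out_not_stat_tenable:
  assumes "stat_tenable {0, 1, 2, 3} cycle3_out B"
  shows "3 \<notin> B"
proof
  assume "3 \<in> B"
  obtain C where C: "C \<subseteq> {0, 1, 2, 3}" "cf cycle3_out C" "B \<subseteq> C" "cogent_as cycle3_out C {0}"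
    by (rule stat_tenableE[OF assms, of "{0}"]) (simp_all add: cf_def)
  then have "C = {3}"
    using \<open>3 \<in> B\<close> by (intro cycle3_out_cf) auto
  then show False
    using C(4) by (simp add: cogency_defs)
qed

lemma cycle3_out_not_cyc_cogent:
  assumes "cyc_cogent {0, 1, 2, 3} cycle3_out B"
  shows "3 \<notin> B"
proof
  assume "3 \<in> B"
  \<comment> \<open>Since \<open>3\<close> attacks nothing, each step of a chain is made by an
    argument of the cycle.\<close>
  let ?S = "{{0}, {1}, {2::nat}}"
  have S: "Y \<in> ?S" if "X \<in> ?S" "Y \<subseteq> {0, 1, 2, 3}" "strictly_cogent cycle3_out Y X" for X Y
  proof -
    have "cf cycle3_out X"
      using that(1) by (auto simp: cf_def)
    with that(3) obtain x a where "a \<in> Y" "(a, x) \<in> cycle3_out"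
      by (rule strictly_cogentE)
    then have "a \<in> {0, 1, 2}"
      by auto
    moreover have "Y = {a}"
      using cycle3_out_cf[OF that(2) _ \<open>a \<in> Y\<close>] that(3) unfolding strictly_cogent_def cogent_as_def by metis
    ultimately show ?thesis
      by simp
  qed
  have "\<not> cyc_cogent {0, 1, 2, 3} cycle3_out {3}"
  proof (rule not_cyc_cogentI[of "{0}" ?S])
    show "strictly_cogent cycle3_out {0} {3}"
      by (simp add: cogency_defs)
  qed (use S in simp_all)
  moreover have "B = {3}"
    using cyc_cogent_subset_cf[OF assms] \<open>3 \<in> B\<close> cycle3_out_cf[of B 3] by metis
  ultimately show False
    using assms by simp
qed

text \<open>The only challenge to \<open>{0}\<close> is \<open>{2}\<close>, which cannot be enlarged, so Pro may answer with \<open>3\<close>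
  although \<open>1\<close> attacks \<open>3\<close>.\<close>

abbreviation rel4 :: "(nat \<times> nat) set" where
  "rel4 \<equiv> {(1, 3), (2, 0), (2, 1), (2, 3), (3, 2)}"

lemma rel4_cf:
  assumes "B \<subseteq> {0, 1, 2, 3}" "cf rel4 B" "2 \<in> B"
  shows "B = {2}"
proof -
  have "b = 2" if "b \<in> B" for b
  proof -
    have "(2, b) \<notin> rel4"
      using assms(2,3) that unfolding cf_def by blast
    moreover have "b \<in> {0, 1, 2, 3}"
      using assms(1) that by blast
    ultimately show ?thesis
      by auto
  qed
  then show ?thesis
    using assms(3) by blast
qed

lemma rel4_strongly_tenable: "strongly_tenable {0, 1, 2, 3} rel4 {0}"
  unfolding strongly_tenable_def strong_dispute_eq
proof (rule pro_wins_one_round)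
  fix B :: "nat set"
  assume B: "B \<subseteq> {0, 1, 2, 3}" "cf rel4 B" "\<not> cogent_as rel4 {0} B"
  have "2 \<in> B"
    using B(3) by (auto simp: cogency_defs)
  then have "B = {2}"
    using rel4_cf B by blast
  moreover have "cogent_as rel4 {0, 3} {2}"
    by (simp add: cogency_defs)
  ultimately show "\<exists>C. {0} \<subseteq> C \<and> C \<subseteq> {0, 1, 2, 3} \<and> cogent_as rel4 C B \<and>
      (\<forall>D. B \<subseteq> D \<and> D \<subseteq> {0, 1, 2, 3} \<and> cf rel4 D \<longrightarrow> \<not> \<not> cogent_as rel4 C D)"
    using rel4_cf by (intro exI[of _ "{0, 3}"]) blast
qed (simp_all add: cf_def)

text \<open>If \<open>3\<close> is in \<open>B\<close> then \<open>{1}\<close> is a strict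
  challenger, otherwise \<open>{2}\<close>. A chain can leave \<open>{1}\<close> only for
  \<open>{2}\<close>, and cannot leave \<open>{2}\<close>, whose attacker \<open>3\<close> is
  counterattacked.\<close>

lemma rel4_not_cyc_cogent:
  assumes "cyc_cogent {0, 1, 2, 3} rel4 B"
  shows "0 \<notin> B"
proof
  assume 0: "0 \<in> B"
  let ?S = "{{1}, {2::nat}}"
  have "cf rel4 B"
    using cyc_cogent_subset_cf[OF assms] by blast
  then have no2: "2 \<notin> B" and no1: "3 \<in> B \<Longrightarrow> 1 \<notin> B"
    using 0 unfolding cf_def by blast+
  have "strictly_cogent rel4 {1} B" if "3 \<in> B"
    using no2 no1[OF that] that by (auto simp: cogency_defs)
  moreover have "strictly_cogent rel4 {2} B" if "3 \<notin> B"
    using no2 that 0 by (auto simp: cogency_defs)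
  ultimately obtain D where "D \<in> ?S" "strictly_cogent rel4 D B"
    by (metis insertCI)
  moreover have "Y \<in> ?S"
    if "X \<in> ?S" "Y \<subseteq> {0, 1, 2, 3}" "strictly_cogent rel4 Y X" for X Y
  proof -
    have "cf rel4 X"
      using that(1) by (auto simp: cf_def)
    with that(3) obtain x y where xy: "x \<in> X" "y \<in> Y" "(y, x) \<in> rel4" "y \<notin> plus rel4 X"
      by (rule strictly_cogentE)
    have "X = {1} \<or> X = {2}"
      using that(1) by simp
    then have "y = 2"
      using xy(1,3,4) by (elim disjE) (auto simp: plus_def)
    then have "2 \<in> Y"
      using xy(2) by simp
    then show ?thesis
      using rel4_cf[OF that(2)] that(3) by (simp add: strictly_cogent_def cogent_as_def)
  qed
  moreover have "B \<notin> ?S"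
    using 0 by auto
  ultimately have "\<not> cyc_cogent {0, 1, 2, 3} rel4 B"
    by (intro not_cyc_cogentI[of D ?S]) auto
  then show False
    using assms by simp
qed

text \<open>The same two challengers work: if \<open>3\<close> is in \<open>B\<close>, it deletes
  \<open>2\<close>, the only attacker of \<open>1\<close>; otherwise \<open>2\<close> defends itself
  against \<open>3\<close>.\<close>

lemma rel4_not_wadm:
  assumes "wadm {0, 1, 2, 3} rel4 B"
  shows "0 \<notin> B"
proof
  assume 0: "0 \<in> B"
  have no2: "2 \<notin> B" and no1: "3 \<in> B \<Longrightarrow> 1 \<notin> B"
    using wadm_cf[OF assms] 0 unfolding cf_def by blast+
  have "\<not> wadm {0, 1, 2, 3} rel4 B"
  proof (cases "3 \<in> B")
    case True
    show ?thesis
      by (rule not_wadmI[of 1 "{1}"])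
        (use no2 no1[OF True] True in \<open>auto simp: cf_def attacks_def reduct_args_def plus_def\<close>)
  next
    case False
    show ?thesis
      by (rule not_wadmI[of 2 "{2}"])
        (use 0 False no2 in \<open>auto simp: cf_def attacks_def reduct_args_def plus_def\<close>)
  qed
  then show False
    using assms by simp
qed

text \<open>Pro answers \<open>3\<close> with \<open>2\<close>, and \<open>4\<close> with \<open>5\<close>, but cannot play both. In the strong game Opp
  starts with \<open>{3}\<close> and then adds \<open>4\<close> or \<open>1\<close>; adding \<open>4\<close> is illegal in the tenability game because
  \<open>3\<close> remains undefended against \<open>2\<close>.\<close>

abbreviation rel6 :: "(nat \<times> nat) set" where
  "rel6 \<equiv> {(1, 5), (2, 3), (3, 0), (4, 0), (4, 1), (5, 2), (5, 3), (5, 4)}"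

lemma rel6_tenable: "tenable {0, 1, 2, 3, 4, 5} rel6 {0}"
  unfolding tenable_def ten_dispute_eq
proof (rule pro_wins_one_round)
  fix B :: "nat set"
  assume B: "B \<subseteq> {0, 1, 2, 3, 4, 5}" "cf rel6 B" "strictly_cogent rel6 B {0}"
  show "\<exists>C. {0} \<subseteq> C \<and> C \<subseteq> {0, 1, 2, 3, 4, 5} \<and> cogent_as rel6 C B \<and>
      (\<forall>D. B \<subseteq> D \<and> D \<subseteq> {0, 1, 2, 3, 4, 5} \<and> cf rel6 D \<longrightarrow> \<not> strictly_cogent rel6 D C)"
  proof (cases "4 \<in> B")
    case True
    \<comment> \<open>Only \<open>1\<close> could trouble \<open>5\<close>, and it conflicts with
      \<open>4\<close>.\<close>
    have *: "cogent_as rel6 {0, 5} D" if "4 \<in> D" "cf rel6 D" for D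
      using that by (auto simp: cogency_defs)
    show ?thesis
      using * True B(2) by (intro exI[of _ "{0, 5}"]) (auto simp: strictly_cogent_def)
  next
    case False
    then have 3: "3 \<in> B"
      using B(3) by (auto simp: cogency_defs)
    have "cogent_as rel6 {0, 2} B"
      using 3 False B(2) by (auto simp: cogency_defs)
    \<comment> \<open>To counter \<open>2\<close>, \<open>D\<close> would need \<open>5\<close>,
      which attacks \<open>3\<close>.\<close>
    moreover have "\<not> cogent_as rel6 D {0, 2}" if "3 \<in> D" for D
      using that by (auto simp: cogency_defs)
    ultimately show ?thesis
      using 3 by (intro exI[of _ "{0, 2}"]) (auto simp: strictly_cogent_def)
  qed
qed (simp_all add: cf_def)

lemma rel6_not_strongly_tenable:
  assumes "strongly_tenable {0, 1, 2, 3, 4, 5} rel6 B"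
  shows "0 \<notin> B"
proof
  assume 0: "0 \<in> B"
  \<comment> \<open>Only \<open>4\<close> attacks \<open>1\<close>, but it conflicts with
    \<open>0\<close>.\<close>
  have five: "\<not> cogent_as rel6 E {1, 3}" if "0 \<in> E" "5 \<in> E" for E
    using that by (auto simp: cogency_defs)
  \<comment> \<open>Only \<open>5\<close> attacks \<open>4\<close>, but it conflicts with
    \<open>2\<close>.\<close>
  have two: "\<not> cogent_as rel6 E {3, 4}" if "0 \<in> E" "2 \<in> E" for E
    using that by (auto simp: cogency_defs)
  have three: "2 \<in> E \<or> 5 \<in> E" if "0 \<in> E" "cogent_as rel6 E {3}" for E
    using that by (auto simp: cogency_defs)
  have cf: "cf rel6 {1, 3}" "cf rel6 {3, 4}" "cf rel6 {3}"
    by (simp_all add: cf_def)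
  obtain s where s: "pro_wins (dispute (\<lambda>P X. \<not> cogent_as rel6 P X) {0, 1, 2, 3, 4, 5} rel6) B s"
    using assms by (auto simp: strongly_tenable_def strong_dispute_eq)
  note round = pro_wins_two_rounds[OF s]
  consider "5 \<in> B" | "2 \<in> B" | "2 \<notin> B" "5 \<notin> B" by blast
  then show False
  proof cases
    case 1
    obtain C where "B \<subseteq> C" "cogent_as rel6 C {1, 3}"
      by (rule round[of "{1, 3}"]) (use five[OF 0 1] cf in auto)
    then show False
      using five[of C] 0 1 by blast
  next
    case 2
    obtain C where "B \<subseteq> C" "cogent_as rel6 C {3, 4}"
      by (rule round[of "{3, 4}"]) (use two[OF 0 2] cf in auto)
    then show False
      using two[of C] 0 2 by blast
  next
    case 3
    then have "\<not> cogent_as rel6 B {3}"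
      using three 0 by blast
    then show False
    proof (rule round[rotated 3])
      fix C
      assume C: "B \<subseteq> C" "cogent_as rel6 C {3}"
        and E: "\<And>D. {3} \<subseteq> D \<Longrightarrow> D \<subseteq> {0, 1, 2, 3, 4, 5} \<Longrightarrow> cf rel6 D \<Longrightarrow> \<not> cogent_as rel6 C D \<Longrightarrow>
          \<exists>E. C \<subseteq> E \<and> E \<subseteq> {0, 1, 2, 3, 4, 5} \<and> cogent_as rel6 E D"
      have "0 \<in> C"
        using C(1) 0 by blast
      from three[OF this C(2)] show False
      proof
        assume "2 \<in> C"
        obtain E where "C \<subseteq> E" "cogent_as rel6 E {3, 4}"
          using E[OF _ _ cf(2) two[OF \<open>0 \<in> C\<close> \<open>2 \<in> C\<close>]] by auto
        then show False
          using two[of E] \<open>0 \<in> C\<close> \<open>2 \<in> C\<close> by blast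
      next
        assume "5 \<in> C"
        obtain E where "C \<subseteq> E" "cogent_as rel6 E {1, 3}"
          using E[OF _ _ cf(1) five[OF \<open>0 \<in> C\<close> \<open>5 \<in> C\<close>]] by auto
        then show False
          using five[of E] \<open>0 \<in> C\<close> \<open>5 \<in> C\<close> by blast
      qed
    qed (use cf in simp_all)
  qed
qed

text \<open>Either answer to \<open>{3}\<close>, by \<open>0\<close> or by \<open>1\<close>, is refuted by a later addition (\<open>2\<close> or \<open>5\<close>), but each
  of the sets \<open>{2, 3}\<close> and \<open>{3, 5}\<close> has an answer when played at once.\<close>

abbreviation rel6' :: "(nat \<times> nat) set" where
  "rel6' \<equiv> {(0, 1), (0, 3), (0, 5), (1, 3), (2, 0), (3, 4), (5, 1), (5, 2)}"

lemma rel6'_stat_tenable: "stat_tenable {0, 1, 2, 3, 4, 5} rel6' {4}"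
  unfolding stat_tenable_def
proof (intro conjI allI impI)
  fix B :: "nat set"
  assume B: "B \<subseteq> {0, 1, 2, 3, 4, 5} \<and> finite B \<and> cf rel6' B"
  \<comment> \<open>Having \<open>5\<close> in \<open>B\<close> excludes \<open>2\<close>, the
    attacker of \<open>0\<close>; lacking \<open>5\<close>, \<open>B\<close> cannot trouble
    \<open>1\<close>, as \<open>0\<close> conflicts with \<open>3\<close>.\<close>
  consider "3 \<notin> B" | "3 \<in> B" "5 \<in> B" | "3 \<in> B" "5 \<notin> B" by blast
  then show "\<exists>C. C \<subseteq> {0, 1, 2, 3, 4, 5} \<and> cf rel6' C \<and> {4} \<subseteq> C \<and> cogent_as rel6' C B"
  proof cases
    case 1
    then show ?thesis
      by (intro exI[of _ "{4}"]) (auto simp: cogency_defs)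
  next
    case 2
    then show ?thesis
      using B by (intro exI[of _ "{0, 4}"]) (auto simp: cogency_defs)
  next
    case 3
    then show ?thesis
      using B by (intro exI[of _ "{1, 4}"]) (auto simp: cogency_defs)
  qed
qed simp

lemma rel6'_not_tenable:
  assumes "tenable {0, 1, 2, 3, 4, 5} rel6' B"
  shows "4 \<notin> B"
proof
  assume 4: "4 \<in> B"
  \<comment> \<open>Countering \<open>2\<close> takes \<open>5\<close>, which \<open>0\<close>
    attacks; in \<open>one\<close>, countering \<open>5\<close> takes \<open>0\<close>, which
    attacks \<open>1\<close>.\<close>
  have zero: "\<not> cogent_as rel6' E {2, 3}" if "4 \<in> E" "0 \<in> E" for E
    using that by (auto simp: cogency_defs)
  have one: "\<not> cogent_as rel6' E {3, 5}" if "4 \<in> E" "1 \<in> E" for E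
    using that by (auto simp: cogency_defs)
  have three: "0 \<in> E \<or> 1 \<in> E" if "4 \<in> E" "cogent_as rel6' E {3}" for E
    using that by (auto simp: cogency_defs)
  have zero': "strictly_cogent rel6' {2, 3} E" if "4 \<in> E" "0 \<in> E" "cf rel6' E" for E
    using zero[OF that(1,2)] that by (auto simp: cogency_defs)
  have one': "strictly_cogent rel6' {3, 5} E" if "4 \<in> E" "1 \<in> E" "cf rel6' E" for E
    using one[OF that(1,2)] that by (auto simp: cogency_defs)
  have cf: "cf rel6' {2, 3}" "cf rel6' {3, 5}" "cf rel6' {3}"
    by (simp_all add: cf_def)
  obtain s where s: "pro_wins (dispute (\<lambda>P X. strictly_cogent rel6' X P) {0, 1, 2, 3, 4, 5} rel6') B s"
    using assms by (auto simp: tenable_def ten_dispute_eq)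
  note round = pro_wins_two_rounds[OF s]
  have cfB: "cf rel6' B"
    using tenable_subset_cf[OF assms] by blast
  consider "0 \<in> B" | "1 \<in> B" | "0 \<notin> B" "1 \<notin> B" by blast
  then show False
  proof cases
    case 1
    obtain C where "B \<subseteq> C" "cogent_as rel6' C {2, 3}"
      by (rule round[of "{2, 3}"]) (use zero'[OF 4 1 cfB] cf in auto)
    then show False
      using zero[of C] 4 1 by blast
  next
    case 2
    obtain C where "B \<subseteq> C" "cogent_as rel6' C {3, 5}"
      by (rule round[of "{3, 5}"]) (use one'[OF 4 2 cfB] cf in auto)
    then show False
      using one[of C] 4 2 by blast
  next
    case 3
    then have "\<not> cogent_as rel6' B {3}"
      using three 4 by blast
    moreover have "cogent_as rel6' {3} B"
      using 3 by (auto simp: cogency_defs intro!: gr0I)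
    ultimately have "strictly_cogent rel6' {3} B"
      by (simp add: strictly_cogent_def)
    then show False
    proof (rule round[rotated 3])
      fix C
      assume C: "B \<subseteq> C" "cogent_as rel6' C {3}"
        and E: "\<And>D. {3} \<subseteq> D \<Longrightarrow> D \<subseteq> {0, 1, 2, 3, 4, 5} \<Longrightarrow> cf rel6' D \<Longrightarrow> strictly_cogent rel6' D C \<Longrightarrow>
          \<exists>E. C \<subseteq> E \<and> E \<subseteq> {0, 1, 2, 3, 4, 5} \<and> cogent_as rel6' E D"
      have 4: "4 \<in> C"
        using C(1) 4 by blast
      have cfC: "cf rel6' C"
        using C(2) by (simp add: cogent_as_def)
      from three[OF 4 C(2)] show False
      proof
        assume "0 \<in> C"
        then obtain E where "C \<subseteq> E" "cogent_as rel6' E {2, 3}"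
          using E[of "{2, 3}"] zero'[OF 4 _ cfC] cf(1) by blast
        then show False
          using zero[of E] 4 \<open>0 \<in> C\<close> by blast
      next
        assume "1 \<in> C"
        then obtain E where "C \<subseteq> E" "cogent_as rel6' E {3, 5}"
          using E[of "{3, 5}"] one'[OF 4 _ cfC] cf(2) by blast
        then show False
          using one[of E] 4 \<open>1 \<in> C\<close> by blast
      qed
    qed (use cf in simp_all)
  qed
qed

subsection \<open>Composition along the graph\<close>

lemma ext_subset: "A \<in> ext \<sigma> F R \<Longrightarrow> A \<subseteq> F"
  by (cases \<sigma>)
    (auto simp: cogent_def cyc_cogent_def weakly_complete_def stat_tenable_def
      dest: wadm_subset strongly_tenable_subset_cf tenable_subset_cf)

lemma solid_ext:
  assumes "(\<sigma>, \<tau>) \<in> solid" "finite F"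
  shows "ext \<sigma> F R \<subseteq> ext \<tau> F R"
proof -
  have "cyc_cogent F R E" if "cogent F R E" for E
    using that by (simp add: cogent_def cyc_cogent_def)
  then show ?thesis
    using assms
    by (auto simp: solid_def intro: cogent_imp_wadm cogent_imp_strongly_tenable
      strongly_tenable_imp_tenable tenable_imp_stat_tenable)
qed

lemma dashed_ext:
  assumes "(\<sigma>, \<tau>) \<in> dashed" "finite F" "AF F R" "A \<in> ext \<sigma> F R"
  shows "\<exists>B\<in>ext \<tau> F R. A \<subseteq> B"
proof -
  consider "\<sigma> = StaTen" "\<tau> = WC" | "\<sigma> = WAd" "\<tau> = WC"
    using assms(1) by (auto simp: dashed_def)
  then show ?thesis
  proof cases
    case 1
    have "\<exists>B. weakly_complete F R B \<and> A \<subseteq> B"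
    proof (rule ex_weakly_complete_superset[where P = "stat_tenable F R"])
      show "B \<subseteq> F \<and> cf R B" if "stat_tenable F R B" for B
        using that stat_tenable_cf by (auto simp: stat_tenable_def)
    qed (use 1 assms in \<open>auto intro: stat_tenable_insert\<close>)
    then show ?thesis
      using 1 by auto
  next
    case 2
    have "\<exists>B. weakly_complete F R B \<and> A \<subseteq> B"
      by (rule ex_weakly_complete_superset[where P = "wadm F R"])
        (use 2 assms in \<open>auto intro: wadm_insert dest: wadm_subset wadm_cf\<close>)
    then show ?thesis
      using 2 by auto
  qed
qed

lemma path_ext:
  assumes "(\<sigma>, \<tau>) \<in> (solid \<union> dashed)\<^sup>*" "finite F" "AF F R" "A \<in> ext \<sigma> F R"
  shows "\<exists>B\<in>ext \<tau> F R. A \<subseteq> B"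
  using assms(1)
proof induction
  case base
  then show ?case
    using assms(4) by blast
next
  case (step \<tau> \<upsilon>)
  then obtain B where B: "B \<in> ext \<tau> F R" "A \<subseteq> B"
    by blast
  have "\<exists>C\<in>ext \<upsilon> F R. B \<subseteq> C"
    using step(2) solid_ext[of \<tau> \<upsilon> F R] dashed_ext[of \<tau> \<upsilon> F R B] assms(2,3) B(1) by blast
  then show ?case
    using B(2) by blast
qed

definition separated :: "sem \<Rightarrow> sem \<Rightarrow> bool" where
  "separated \<sigma> \<tau> \<longleftrightarrow> (\<exists>(F :: nat set) R. finite F \<and> AF F R \<and>
     (\<exists>A \<in> ext \<sigma> F R. \<not> (\<exists>B \<in> ext \<tau> F R. A \<subseteq> B)))"

lemma separatedI:
  fixes F :: "nat set"
  assumes "finite F" "AF F R" "{a} \<in> ext \<sigma> F R" "\<And>B. B \<in> ext \<tau> F R \<Longrightarrow> a \<notin> B"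
  shows "separated \<sigma> \<tau>"
  using assms unfolding separated_def by blast

text \<open>\<open>A\<close> extends to a \<open>\<sigma>'\<close>-extension \<open>A'\<close>; a
  \<open>\<tau>'\<close>-extension containing \<open>A'\<close> would in turn extend to a
  \<open>\<tau>\<close>-extension containing \<open>A\<close>.\<close>

lemma separated_mono:
  assumes "separated \<sigma> \<tau>" "(\<sigma>, \<sigma>') \<in> (solid \<union> dashed)\<^sup>*" "(\<tau>', \<tau>) \<in> (solid \<union> dashed)\<^sup>*"
  shows "separated \<sigma>' \<tau>'"
proof -
  obtain F :: "nat set" and R A where F: "finite F" "AF F R" and A: "A \<in> ext \<sigma> F R"
    and sep: "\<And>B. B \<in> ext \<tau> F R \<Longrightarrow> \<not> A \<subseteq> B"
    using assms(1) unfolding separated_def by blast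
  obtain A' where A': "A' \<in> ext \<sigma>' F R" "A \<subseteq> A'"
    using path_ext[OF assms(2) F A] by blast
  have "\<not> A' \<subseteq> B" if "B \<in> ext \<tau>' F R" for B
    using path_ext[OF assms(3) F that] sep A'(2) by blast
  then show ?thesis
    using F A'(1) unfolding separated_def by blast
qed

lemma separated_base:
  "separated CyCog WC" "separated WAd StaTen" "separated WAd CyCog" "separated StrTen CyCog"
  "separated StrTen WAd" "separated Ten StrTen" "separated StaTen Ten"
proof -
  show "separated CyCog WC"
    by (rule separatedI[of "{0, 1, 2}" cycle3 0])
      (use cycle3_cyc_cogent cycle3_not_weakly_complete in \<open>simp_all add: AF_def\<close>)
  show "separated WAd StaTen" "separated WAd CyCog"
    by (rule separatedI[of "{0, 1, 2, 3}" cycle3_out 3];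
      use cycle3_out_wadm cycle3_out_not_stat_tenable cycle3_out_not_cyc_cogent in \<open>simp add: AF_def\<close>)+
  show "separated StrTen CyCog" "separated StrTen WAd"
    by (rule separatedI[of "{0, 1, 2, 3}" rel4 0];
      use rel4_strongly_tenable rel4_not_cyc_cogent rel4_not_wadm in \<open>simp add: AF_def\<close>)+
  show "separated Ten StrTen"
    by (rule separatedI[of "{0, 1, 2, 3, 4, 5}" rel6 0])
      (use rel6_tenable rel6_not_strongly_tenable in \<open>simp_all add: AF_def\<close>)
  show "separated StaTen Ten"
    by (rule separatedI[of "{0, 1, 2, 3, 4, 5}" rel6' 4])
      (use rel6'_stat_tenable rel6'_not_tenable in \<open>simp_all add: AF_def\<close>)
qed

lemma separated_if_no_path:
  assumes "\<sigma> \<noteq> \<tau>" "(\<sigma>, \<tau>) \<notin> (solid \<union> dashed)\<^sup>+"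
  shows "separated \<sigma> \<tau>"
proof -
  let ?E = "(solid \<union> dashed)\<^sup>*"
  have edges: "(Cog, CyCog) \<in> ?E" "(Cog, WAd) \<in> ?E" "(Cog, StrTen) \<in> ?E" "(StrTen, Ten) \<in> ?E"
    "(Ten, StaTen) \<in> ?E" "(StaTen, WC) \<in> ?E" "(WAd, WC) \<in> ?E"
    by (auto simp: solid_def dashed_def)
  have trans: "(x, z) \<in> ?E" if "(x, y) \<in> ?E" "(y, z) \<in> ?E" for x y z
    using that by (rule rtrancl_trans)
  have refl: "(x, x) \<in> ?E" for x
    by simp
  \<comment> \<open>All pairs joined by a path, including the trivial ones.\<close>
  note paths = edges refl trans[OF edges(3,4)] trans[OF edges(4,5)] trans[OF edges(5,6)]
    trans[OF edges(2,7)] trans[OF edges(3) trans[OF edges(4,5)]]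
    trans[OF edges(4) trans[OF edges(5,6)]]
  note sep = separated_base[THEN separated_mono]
  have no_path: "(\<sigma>, \<tau>) \<notin> ?E"
    using assms by (simp add: rtrancl_eq_or_trancl)
  \<comment> \<open>Connected pairs contradict \<open>no_path\<close>; for the others, backtracking
    finds a base separation and the two paths that transfer it.\<close>
  show ?thesis
    using no_path
    by (cases \<sigma>; cases \<tau>) (simp_all add: paths, (rule sep, rule paths, rule paths)+)
qed

text \<open>The unattacked argument \<open>0\<close> can be neither \<open>Out\<close> nor
  \<open>Undec\<close>.\<close>

lemma empty_not_weakly_complete:
  "{} \<in> ext Cog {0::nat} {}" "{} \<notin> ext WC {0::nat} {}"
proof -
  show "{} \<in> ext Cog {0::nat} {}"
    by (simp add: cogent_def cogency_defs)
  show "{} \<notin> ext WC {0::nat} {}"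
  proof
    assume "{} \<in> ext WC {0::nat} {}"
    then obtain L where "wc_labeling {0::nat} {} L" "L 0 \<noteq> In"
      by (auto simp: weakly_complete_def)
    then show False
      by (cases "L 0") (auto simp: wc_labeling_def)
  qed
qed

text \<open>If there is no path at all, a separation suffices. Otherwise the target is
  \<open>WC\<close>, and the empty set passes from \<open>Cog\<close> to \<open>\<sigma>\<close>
  along solid edges.\<close>

lemma ex_not_ext_if_no_solid_path:
  assumes "\<sigma> \<noteq> \<tau>" "(\<sigma>, \<tau>) \<notin> solid\<^sup>+"
  shows "\<exists>(F :: nat set) R. finite F \<and> AF F R \<and> (\<exists>A \<in> ext \<sigma> F R. A \<subseteq> F \<and> A \<notin> ext \<tau> F R)"
proof (cases "(\<sigma>, \<tau>) \<in> (solid \<union> dashed)\<^sup>+")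
  case False
  then have "separated \<sigma> \<tau>"
    using assms(1) separated_if_no_path by blast
  then obtain F :: "nat set" and R A where "finite F" "AF F R" and A: "A \<in> ext \<sigma> F R" "A \<notin> ext \<tau> F R"
    unfolding separated_def by blast
  then show ?thesis
    using ext_subset[OF A(1)] by blast
next
  case True
  \<comment> \<open>Dashed edges end in the sink \<open>WC\<close>.\<close>
  have "\<tau> = WC \<or> (\<sigma>, \<tau>) \<in> solid\<^sup>+"
    using True
  proof induction
    case (base \<upsilon>)
    then show ?case
      by (auto simp: dashed_def)
  next
    case (step \<upsilon> \<omega>)
    have "\<omega> = WC" if "(\<upsilon>, \<omega>) \<in> dashed"
      using that by (auto simp: dashed_def)
    moreover have "(\<sigma>, \<omega>) \<in> solid\<^sup>+" if "(\<upsilon>, \<omega>) \<in> solid"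
    proof -
      have "\<upsilon> \<noteq> WC"
        using that by (auto simp: solid_def)
      then have "(\<sigma>, \<upsilon>) \<in> solid\<^sup>+"
        using step.IH by blast
      then show ?thesis
        using that by (rule trancl_into_trancl)
    qed
    ultimately show ?case
      using step.hyps(2) by blast
  qed
  then have "\<tau> = WC"
    using assms(2) by blast
  obtain \<upsilon> where "(\<sigma>, \<upsilon>) \<in> solid \<union> dashed"
    using tranclD[OF True] by blast
  \<comment> \<open>Every semantics with an outgoing edge is reachable from \<open>Cog\<close> by
    solid edges.\<close>
  then have "(Cog, \<sigma>) \<in> solid\<^sup>*"
  proof -
    have "(Cog, StrTen) \<in> solid" "(StrTen, Ten) \<in> solid" "(Ten, StaTen) \<in> solid" "(Cog, WAd) \<in> solid"
      by (simp_all add: solid_def)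
    moreover have "\<sigma> \<in> {Cog, WAd, StrTen, Ten, StaTen}"
      using \<open>(\<sigma>, \<upsilon>) \<in> solid \<union> dashed\<close> by (auto simp: solid_def dashed_def)
    ultimately show ?thesis
      by (auto intro: rtrancl_into_rtrancl)
  qed
  then have "ext Cog {0::nat} {} \<subseteq> ext \<sigma> {0} {}"
  proof induction
    case (step \<upsilon> \<omega>)
    then show ?case
      using solid_ext[of \<upsilon> \<omega> "{0::nat}" "{}"] by blast
  qed simp
  then have "{} \<in> ext \<sigma> {0::nat} {}"
    using empty_not_weakly_complete(1) by blast
  then show ?thesis
    using empty_not_weakly_complete(2) \<open>\<tau> = WC\<close>
    by (intro exI[of _ "{0}"] exI[of _ "{}"] conjI bexI[of _ "{}"]) (simp_all add: AF_def)
qed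

theorem theorem9:
  shows
   "(\<forall>\<sigma> \<tau>. (\<sigma>, \<tau>) \<in> solid \<longrightarrow>
       (\<forall>(F :: 'a set) R. finite F \<and> AF F R \<longrightarrow> ext \<sigma> F R \<subseteq> ext \<tau> F R)) \<and>
    (\<forall>\<sigma> \<tau>. (\<sigma>, \<tau>) \<in> dashed \<longrightarrow>
       (\<forall>(F :: 'a set) R. finite F \<and> AF F R \<longrightarrow>
          (\<forall>A \<in> ext \<sigma> F R. \<exists>B \<in> ext \<tau> F R. A \<subseteq> B))) \<and>
    (\<forall>\<sigma> \<tau>. \<sigma> \<noteq> \<tau> \<and> (\<sigma>, \<tau>) \<notin> (solid \<union> dashed)\<^sup>+ \<longrightarrow>
       (\<exists>(F :: nat set) R. finite F \<and> AF F R \<and>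
          (\<exists>A \<in> ext \<sigma> F R. \<not> (\<exists>B \<in> ext \<tau> F R. A \<subseteq> B)))) \<and>
    (\<forall>\<sigma> \<tau>. \<sigma> \<noteq> \<tau> \<and> (\<sigma>, \<tau>) \<notin> solid\<^sup>+ \<longrightarrow>
       (\<exists>(F :: nat set) R. finite F \<and> AF F R \<and>
          (\<exists>A \<in> ext \<sigma> F R. A \<subseteq> F \<and> A \<notin> ext \<tau> F R)))"
proof (intro conjI allI impI ballI)
  show "ext \<sigma> F R \<subseteq> ext \<tau> F R"
    if "(\<sigma>, \<tau>) \<in> solid" "finite F \<and> AF F R" for \<sigma> \<tau> and F :: "'a set" and R
    using solid_ext[of \<sigma> \<tau> F R] that by blast
  show "\<exists>B\<in>ext \<tau> F R. A \<subseteq> B"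
    if "(\<sigma>, \<tau>) \<in> dashed" "finite F \<and> AF F R" "A \<in> ext \<sigma> F R"
    for \<sigma> \<tau> and F :: "'a set" and R A
    using dashed_ext[of \<sigma> \<tau> F R A] that by blast
  show "\<exists>(F :: nat set) R. finite F \<and> AF F R \<and> (\<exists>A\<in>ext \<sigma> F R. \<not> (\<exists>B\<in>ext \<tau> F R. A \<subseteq> B))"
    if "\<sigma> \<noteq> \<tau> \<and> (\<sigma>, \<tau>) \<notin> (solid \<union> dashed)\<^sup>+" for \<sigma> \<tau>
    using separated_if_no_path[of \<sigma> \<tau>] that unfolding separated_def by blast
  show "\<exists>(F :: nat set) R. finite F \<and> AF F R \<and> (\<exists>A\<in>ext \<sigma> F R. A \<subseteq> F \<and> A \<notin> ext \<tau> F R)"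
    if "\<sigma> \<noteq> \<tau> \<and> (\<sigma>, \<tau>) \<notin> solid\<^sup>+" for \<sigma> \<tau>
    using ex_not_ext_if_no_solid_path[of \<sigma> \<tau>] that by blast
qed

end
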